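(* Let $n\ge 3$ be an integer that is not of the form $2r$ with $r$ odd. Then there exists a pair of orthogonal Latin squares $A$, $B$ of order $n$, neither of which is double-diagonal, such that $A+_S B$ is a magic square of order $n$.
   Context: A Latin square of order $n$ is an $n\times n$ array with entries in $\{1,\dots,n\}$ in which each symbol occurs exactly once in each row and each column. Two Latin squares $(a_{ij})$, $(b_{ij})$ of order $n$ are orthogonal if the $n^2$ ordered pairs $(a_{ij},b_{ij})$ are all distinct. A Latin square of order $n$ is double-diagonal if the $n$ entries on its main diagonal are all distinct and the $n$ entries on its antidiagonal are all distinct. For orthogonal Latin squares $A=(a_{ij})$, $B=(b_{ij})$ of order $n$, $A+_S B$ denotes the $n\times n$ square with $(i,j)$ entry $n(a_{ij}-1)+b_{ij}$. A magic square of order $n$ is an $n\times n$ array containing $n^2$ consecutive integers (each exactly once; here $1,2,\dots,n^2$) such that the sums of each row, each column, the main diagonal, and the antidiagonal are all the same. *)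

theory Defs
  imports Main
begin

text \<open>
  An \<open>n \<times> n\<close> array is a function of a row and a column index, both ranging over
  \<open>{1..n}\<close>; its values elsewhere are never inspected. Entries are integers, so that the
  subtraction in \<open>square_sum\<close> is not truncated.
\<close>

type_synonym square = "nat \<Rightarrow> nat \<Rightarrow> int"

definition latin_square :: "nat \<Rightarrow> square \<Rightarrow> bool" where
  "latin_square n A \<longleftrightarrow>
     (\<forall>i\<in>{1..n}. \<forall>j\<in>{1..n}. A i j \<in> {1..int n}) \<and>
     (\<forall>i\<in>{1..n}. \<forall>k\<in>{1..int n}. \<exists>!j. j \<in> {1..n} \<and> A i j = k) \<and>
     (\<forall>j\<in>{1..n}. \<forall>k\<in>{1..int n}. \<exists>!i. i \<in> {1..n} \<and> A i j = k)"

definition orthogonal_squares :: "nat \<Rightarrow> square \<Rightarrow> square \<Rightarrow> bool" where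
  "orthogonal_squares n A B \<longleftrightarrow>
     inj_on (\<lambda>(i, j). (A i j, B i j)) ({1..n} \<times> {1..n})"

definition double_diagonal :: "nat \<Rightarrow> square \<Rightarrow> bool" where
  "double_diagonal n A \<longleftrightarrow>
     inj_on (\<lambda>i. A i i) {1..n} \<and> inj_on (\<lambda>i. A i (n + 1 - i)) {1..n}"

definition square_sum :: "nat \<Rightarrow> square \<Rightarrow> square \<Rightarrow> square" where
  "square_sum n A B = (\<lambda>i j. int n * (A i j - 1) + B i j)"

definition magic_square :: "nat \<Rightarrow> square \<Rightarrow> bool" where
  "magic_square n M \<longleftrightarrow>
     bij_betw (\<lambda>(i, j). M i j) ({1..n} \<times> {1..n}) {1..(int n)\<^sup>2} \<and>
     (\<exists>s. (\<forall>i\<in>{1..n}. (\<Sum>j=1..n. M i j) = s) \<and>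
          (\<forall>j\<in>{1..n}. (\<Sum>i=1..n. M i j) = s) \<and>
          (\<Sum>i=1..n. M i i) = s \<and>
          (\<Sum>i=1..n. M i (n + 1 - i)) = s)"

end

theory Submission
  imports Defs "HOL-Number_Theory.Cong"
begin

text \<open>
  If \<open>A\<close> and \<open>B\<close> have the same sum as \<open>1 + \<dots> + n\<close> on both diagonals, then
  \<open>A +\<^sub>S B\<close> is magic; this balance does not force the diagonal entries to be distinct.
  For odd \<open>n\<close>, the cyclic squares \<open>i + j\<close> and \<open>i - j\<close>, suitably shifted, each have one
  diagonal constantly equal to the middle symbol. In orders 4 and 8, take squares
  \<open>f i + g j\<close> with \<open>f\<close>, \<open>g\<close> linear bijections over the field with two elements such that
  \<open>f + g\<close> is singular but has the all-ones vector in its image: diagonal entries then pair up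
  as complements. All conditions survive Kronecker products, and every multiple of 4 is a product
  of odd numbers, 4s and 8s.
\<close>

section \<open>Balanced squares on \<open>0, ..., n-1\<close> and their Kronecker products\<close>

text \<open>Rows, columns and symbols start at 0, so that \<open>div\<close> and \<open>mod\<close>
  split them into digits and residues need no adjustment. All quantifiers are bounded, which makes
  small orders decidable by evaluation.\<close>

definition balanced_latin :: "nat \<Rightarrow> (nat \<Rightarrow> nat \<Rightarrow> nat) \<Rightarrow> bool" where
  "balanced_latin n L \<longleftrightarrow>
     (\<forall>i<n. \<forall>j<n. L i j < n) \<and>
     (\<forall>i<n. inj_on (L i) {..<n}) \<and>
     (\<forall>j<n. inj_on (\<lambda>i. L i j) {..<n}) \<and>
     (\<Sum>i<n. L i i) = \<Sum>{..<n} \<and>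
     (\<Sum>i<n. L i (n - Suc i)) = \<Sum>{..<n}"

definition distinct_diagonals :: "nat \<Rightarrow> (nat \<Rightarrow> nat \<Rightarrow> nat) \<Rightarrow> bool" where
  "distinct_diagonals n L \<longleftrightarrow>
     inj_on (\<lambda>i. L i i) {..<n} \<and> inj_on (\<lambda>i. L i (n - Suc i)) {..<n}"

definition orthogonal :: "nat \<Rightarrow> (nat \<Rightarrow> nat \<Rightarrow> nat) \<Rightarrow> (nat \<Rightarrow> nat \<Rightarrow> nat) \<Rightarrow> bool" where
  "orthogonal n K L \<longleftrightarrow> inj_on (\<lambda>(i, j). (K i j, L i j)) ({..<n} \<times> {..<n})"

text \<open>A two-digit number: the high digit is the entry of \<open>K\<close> at the block
  position, the low digit the entry of \<open>L\<close> at the position inside the block. The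
  parameter \<open>m\<close> is the order of \<open>L\<close>.\<close>

definition kronecker ::
    "nat \<Rightarrow> (nat \<Rightarrow> nat \<Rightarrow> nat) \<Rightarrow> (nat \<Rightarrow> nat \<Rightarrow> nat) \<Rightarrow> nat \<Rightarrow> nat \<Rightarrow> nat" where
  "kronecker m K L = (\<lambda>i j. m * K (i div m) (j div m) + L (i mod m) (j mod m))"

lemma mult_add_less_mult:
  fixes a b k m :: nat
  assumes "a < k" "b < m"
  shows "m * a + b < k * m"
proof -
  have "m * a + b < m * Suc a" using assms by simp
  also have "\<dots> \<le> m * k" using assms by (intro mult_le_mono) auto
  finally show ?thesis by (simp add: mult.commute)
qed

lemma mult_add_eq_iff:
  fixes a b c d m :: nat
  assumes "b < m" "d < m"
  shows "m * a + b = m * c + d \<longleftrightarrow> a = c \<and> b = d"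
proof
  assume eq: "m * a + b = m * c + d"
  have "a = (m * a + b) div m" "b = (m * a + b) mod m" using assms by auto
  then show "a = c \<and> b = d" using assms eq by auto
qed simp

lemma div_mod_eqI:
  fixes x y m :: nat
  assumes "x div m = y div m" "x mod m = y mod m"
  shows "x = y"
  by (metis assms div_mult_mod_eq)

lemma sum_div_mod:
  fixes g :: "nat \<Rightarrow> nat \<Rightarrow> nat"
  assumes "m > 0"
  shows "(\<Sum>x<k*m. g (x div m) (x mod m)) = (\<Sum>a<k. \<Sum>b<m. g a b)"
proof -
  have "(\<Sum>x<k*m. g (x div m) (x mod m)) = (\<Sum>(a, b)\<in>{..<k} \<times> {..<m}. g a b)"
    using assms
    by (intro sum.reindex_bij_witness[where i = "\<lambda>(a, b). m * a + b" and j = "\<lambda>x. (x div m, x mod m)"])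
      (auto simp: less_mult_imp_div_less mult_add_less_mult)
  then show ?thesis by (simp add: sum.cartesian_product)
qed

text \<open>The number \<open>k * m - 1\<close> has the maximal digits \<open>k - 1\<close> and
  \<open>m - 1\<close>, so subtracting \<open>i\<close> from it never borrows. Hence antidiagonal
  cells of a Kronecker product come from antidiagonal cells of both factors.\<close>

lemma reflect_div_mod:
  fixes i k m :: nat
  assumes "i < k * m"
  shows "(k * m - Suc i) div m = k - Suc (i div m)" "(k * m - Suc i) mod m = m - Suc (i mod m)"
proof -
  have m: "m > 0" using assms by (cases m) auto
  define a b where "a = i div m" and "b = i mod m"
  have i: "i = m * a + b" by (simp add: a_def b_def)
  have a: "a < k" using assms by (simp add: a_def less_mult_imp_div_less)
  have b: "b < m" using m by (simp add: b_def)
  \<comment> \<open>Naming the slacks turns truncated subtraction into addition; \<open>c\<close>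
    and \<open>d\<close> are the digits of the reflected index.\<close>
  obtain c where c: "k = Suc (a + c)" using a less_imp_Suc_add by blast
  obtain d where d: "m = Suc (b + d)" using b less_imp_Suc_add by blast
  have "k * m - Suc i = m * c + d"
    unfolding i c by (simp add: d algebra_simps)
  moreover have "d < m" using d by simp
  ultimately have dm: "(k * m - Suc i) div m = c" "(k * m - Suc i) mod m = d" by auto
  have cd: "c = k - Suc a" "d = m - Suc b" using c d by simp_all
  show "(k * m - Suc i) div m = k - Suc (i div m)" "(k * m - Suc i) mod m = m - Suc (i mod m)"
    using dm cd unfolding a_def b_def by (simp_all only:)
qed

text \<open>Each digit enters the sum only through its total, so \<open>f\<close> and
  \<open>g\<close> can be exchanged for the identity. What remains is the sum of all
  \<open>x\<close>, written out in digits.\<close>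

lemma sum_kronecker:
  fixes f g :: "nat \<Rightarrow> nat"
  assumes "m > 0" "sum f {..<k} = \<Sum>{..<k}" "sum g {..<m} = \<Sum>{..<m}"
  shows "(\<Sum>x<k*m. m * f (x div m) + g (x mod m)) = \<Sum>{..<k*m}"
proof -
  have "(\<Sum>x<k*m. m * f (x div m) + g (x mod m)) = (\<Sum>a<k. \<Sum>b<m. m * f a + g b)"
    using assms(1) by (rule sum_div_mod)
  also have "\<dots> = (\<Sum>a<k. \<Sum>b<m. m * a + b)"
    using assms(2,3) by (simp add: sum.distrib flip: sum_distrib_left)
  also have "\<dots> = (\<Sum>x<k*m. m * (x div m) + x mod m)"
    using assms(1) by (rule sum_div_mod[symmetric])
  finally show ?thesis by simp
qed

lemma kronecker_eq_iff:
  assumes "L (i mod m) (j mod m) < m" "L (i' mod m) (j' mod m) < m"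
  shows "kronecker m K L i j = kronecker m K L i' j' \<longleftrightarrow>
    K (i div m) (j div m) = K (i' div m) (j' div m) \<and> L (i mod m) (j mod m) = L (i' mod m) (j' mod m)"
  using assms by (simp add: kronecker_def mult_add_eq_iff)

lemma balanced_latin_kronecker:
  assumes K: "balanced_latin k K" and L: "balanced_latin m L" and "m > 0"
  shows "balanced_latin (k * m) (kronecker m K L)"
proof -
  have div: "i div m < k" if "i < k * m" for i using that by (rule less_mult_imp_div_less)
  have mod: "i mod m < m" for i using \<open>m > 0\<close> by simp
  have ltL: "L (i mod m) (j mod m) < m" for i j using L mod by (auto simp: balanced_latin_def)
  have "kronecker m K L i j < k * m" if "i < k * m" "j < k * m" for i j
    unfolding kronecker_def using that K ltL div
    by (intro mult_add_less_mult) (auto simp: balanced_latin_def)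
  moreover have "inj_on (kronecker m K L i) {..<k*m}" if "i < k * m" for i
  proof (rule inj_onI)
    fix j j' assume j: "j \<in> {..<k*m}" "j' \<in> {..<k*m}" "kronecker m K L i j = kronecker m K L i j'"
    then have "K (i div m) (j div m) = K (i div m) (j' div m)"
      "L (i mod m) (j mod m) = L (i mod m) (j' mod m)"
      using kronecker_eq_iff ltL by auto
    moreover have "inj_on (K (i div m)) {..<k}" "inj_on (L (i mod m)) {..<m}"
      using K L that div mod by (auto simp: balanced_latin_def)
    ultimately show "j = j'"
      using j div mod by (intro div_mod_eqI[of j m j']) (auto dest!: inj_onD)
  qed
  moreover have "inj_on (\<lambda>i. kronecker m K L i j) {..<k*m}" if "j < k * m" for j
  proof (rule inj_onI)
    fix i i' assume i: "i \<in> {..<k*m}" "i' \<in> {..<k*m}" "kronecker m K L i j = kronecker m K L i' j"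
    then have "K (i div m) (j div m) = K (i' div m) (j div m)"
      "L (i mod m) (j mod m) = L (i' mod m) (j mod m)"
      using kronecker_eq_iff ltL by auto
    moreover have "inj_on (\<lambda>i. K i (j div m)) {..<k}" "inj_on (\<lambda>i. L i (j mod m)) {..<m}"
      using K L that div mod by (auto simp: balanced_latin_def)
    ultimately show "i = i'"
      using i div mod by (intro div_mod_eqI[of i m i']) (auto dest!: inj_onD)
  qed
  moreover have "(\<Sum>i<k*m. kronecker m K L i i) = \<Sum>{..<k*m}"
    unfolding kronecker_def using K L \<open>m > 0\<close>
    by (intro sum_kronecker) (auto simp: balanced_latin_def)
  moreover have "(\<Sum>i<k*m. kronecker m K L i (k * m - Suc i)) = \<Sum>{..<k*m}"
  proof -
    have "(\<Sum>i<k*m. kronecker m K L i (k * m - Suc i)) =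
        (\<Sum>i<k*m. m * K (i div m) (k - Suc (i div m)) + L (i mod m) (m - Suc (i mod m)))"
      by (intro sum.cong) (simp_all add: kronecker_def reflect_div_mod)
    also have "\<dots> = \<Sum>{..<k*m}"
      using K L \<open>m > 0\<close> by (intro sum_kronecker) (auto simp: balanced_latin_def)
    finally show ?thesis .
  qed
  ultimately show ?thesis by (auto simp: balanced_latin_def)
qed

text \<open>Equal entries have equal digits: the pair of high digits determines the block, the pair
  of low digits the position inside it.\<close>

lemma orthogonal_kronecker:
  assumes "orthogonal k K K'" "orthogonal m L L'"
    and "balanced_latin m L" "balanced_latin m L'" and "m > 0"
  shows "orthogonal (k * m) (kronecker m K L) (kronecker m K' L')"
  unfolding orthogonal_def
proof (rule inj_onI, clarify)
  fix i j i' j'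
  assume ij: "i < k * m" "j < k * m" "i' < k * m" "j' < k * m"
    and eq: "kronecker m K L i j = kronecker m K L i' j'" "kronecker m K' L' i j = kronecker m K' L' i' j'"
  have mod: "i mod m < m" for i using \<open>m > 0\<close> by simp
  have lt: "L (i mod m) (j mod m) < m" "L' (i mod m) (j mod m) < m" for i j
    using assms(3,4) mod by (auto simp: balanced_latin_def)
  have eqs: "K (i div m) (j div m) = K (i' div m) (j' div m)"
    "K' (i div m) (j div m) = K' (i' div m) (j' div m)"
    "L (i mod m) (j mod m) = L (i' mod m) (j' mod m)"
    "L' (i mod m) (j mod m) = L' (i' mod m) (j' mod m)"
    using eq kronecker_eq_iff lt by auto
  have "(i div m, j div m) = (i' div m, j' div m)"
    using assms(1)[unfolded orthogonal_def] by (rule inj_onD) (use eqs ij in \<open>auto simp: less_mult_imp_div_less\<close>)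
  moreover have "(i mod m, j mod m) = (i' mod m, j' mod m)"
    using assms(2)[unfolded orthogonal_def] by (rule inj_onD) (use eqs mod in auto)
  ultimately show "i = i' \<and> j = j'"
    using div_mod_eqI[of i m i'] div_mod_eqI[of j m j'] by simp
qed

text \<open>At the indices \<open>m * a\<close> the low digit is constantly \<open>L 0 0\<close> on
  the main diagonal and \<open>L 0 (m - 1)\<close> on the antidiagonal, so a repetition on a
  diagonal of \<open>K\<close> survives in the product. It is applied in contrapositive
  form.\<close>

lemma distinct_diagonals_kroneckerD:
  assumes D: "distinct_diagonals (k * m) (kronecker m K L)" and "m > 0"
  shows "distinct_diagonals k K"
proof -
  have lt: "m * a < k * m" if "a < k" for a using mult_add_less_mult[OF that \<open>m > 0\<close>] by simp
  have "inj_on (\<lambda>i. K i i) {..<k}"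
  proof (rule inj_onI)
    fix a a' assume a: "a \<in> {..<k}" "a' \<in> {..<k}" "K a a = K a' a'"
    have "m * a = m * a'"
      by (rule inj_onD[OF D[unfolded distinct_diagonals_def, THEN conjunct1]])
        (use a lt \<open>m > 0\<close> in \<open>auto simp: kronecker_def\<close>)
    then show "a = a'" using \<open>m > 0\<close> by simp
  qed
  moreover have "inj_on (\<lambda>i. K i (k - Suc i)) {..<k}"
  proof (rule inj_onI)
    fix a a' assume a: "a \<in> {..<k}" "a' \<in> {..<k}" "K a (k - Suc a) = K a' (k - Suc a')"
    have "m * a = m * a'"
      by (rule inj_onD[OF D[unfolded distinct_diagonals_def, THEN conjunct2]])
        (use a lt \<open>m > 0\<close> in \<open>auto simp: kronecker_def reflect_div_mod\<close>)
    then show "a = a'" using \<open>m > 0\<close> by simp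
  qed
  ultimately show ?thesis by (simp add: distinct_diagonals_def)
qed

definition balanced_mols :: "nat \<Rightarrow> (nat \<Rightarrow> nat \<Rightarrow> nat) \<Rightarrow> (nat \<Rightarrow> nat \<Rightarrow> nat) \<Rightarrow> bool" where
  "balanced_mols n K L \<longleftrightarrow> balanced_latin n K \<and> balanced_latin n L \<and> orthogonal n K L"

lemma balanced_mols_kronecker:
  assumes "balanced_mols k K K'" "balanced_mols m L L'" "m > 0"
  shows "balanced_mols (k * m) (kronecker m K L) (kronecker m K' L')"
  using assms by (simp add: balanced_mols_def balanced_latin_kronecker orthogonal_kronecker)

section \<open>Odd orders: cyclic squares\<close>

lemma mod_shift_inject:
  fixes a b c n :: nat
  assumes "(a + c) mod n = (b + c) mod n" "a < n" "b < n"
  shows "a = b"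
proof -
  have "[a = b] (mod n)" using assms(1) by (simp add: cong_def[symmetric] cong_add_rcancel_nat)
  then show ?thesis using assms by (simp add: cong_def)
qed

text \<open>The shift \<open>h + 1\<close> puts the middle symbol \<open>h\<close> on the antidiagonal.\<close>

definition cyclic_square :: "nat \<Rightarrow> nat \<Rightarrow> nat \<Rightarrow> nat" where
  "cyclic_square h i j = (i + j + (h + 1)) mod (2 * h + 1)"

lemma cyclic_square_antidiagonal:
  assumes "i < 2 * h + 1"
  shows "cyclic_square h i (2 * h - i) = h"
proof -
  have "i + (2 * h - i) + (h + 1) = h + (2 * h + 1)" using assms by simp
  then have "cyclic_square h i (2 * h - i) = (h + (2 * h + 1)) mod (2 * h + 1)"
    unfolding cyclic_square_def by (rule arg_cong)
  also have "\<dots> = h" unfolding mod_add_self2 by simp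
  finally show ?thesis .
qed

text \<open>2 is invertible modulo an odd number. This gives both the distinct main diagonal of the
  cyclic square and its orthogonality to its mirror image.\<close>

lemma odd_double_mod_inject:
  fixes a b c h :: nat
  assumes "(2 * a + c) mod (2 * h + 1) = (2 * b + c) mod (2 * h + 1)" "a < 2 * h + 1" "b < 2 * h + 1"
  shows "a = b"
proof -
  have "[2 * a = 2 * b] (mod (2 * h + 1))"
    using assms(1) by (simp add: cong_def[symmetric] cong_add_rcancel_nat)
  moreover have "coprime 2 (2 * h + 1)" by simp
  ultimately have "[a = b] (mod (2 * h + 1))" using cong_mult_lcancel_nat coprime_commute by blast
  then show ?thesis using assms by (simp add: cong_def)
qed

lemma cyclic_square_diagonal_inj: "inj_on (\<lambda>i. cyclic_square h i i) {..<2*h+1}"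
proof (rule inj_onI)
  fix a b assume ab: "a \<in> {..<2*h+1}" "b \<in> {..<2*h+1}" "cyclic_square h a a = cyclic_square h b b"
  from ab(3) have "(2 * a + (h + 1)) mod (2 * h + 1) = (2 * b + (h + 1)) mod (2 * h + 1)"
    unfolding cyclic_square_def mult_2 .
  then show "a = b" by (rule odd_double_mod_inject) (use ab in auto)
qed

lemma sum_inj_on_lessThan:
  fixes f :: "nat \<Rightarrow> nat"
  assumes "inj_on f {..<n}" "\<And>i. i < n \<Longrightarrow> f i < n"
  shows "sum f {..<n} = \<Sum>{..<n}"
proof -
  have "f ` {..<n} = {..<n}" using assms by (intro endo_inj_surj) auto
  then show ?thesis using assms(1) sum.reindex[of f "{..<n}" "\<lambda>x. x"] by simp
qed

lemma sum_middle: "(\<Sum>i<2*h+1. h) = \<Sum>{..<2*h+1}" for h :: nat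
  by (induction h) (auto simp: algebra_simps)

lemma cyclic_square_less: "cyclic_square h i j < 2 * h + 1"
  by (simp add: cyclic_square_def)

text \<open>The main diagonal is a permutation; the antidiagonal is constantly \<open>h\<close>, the
  mean of \<open>0, ..., 2 * h\<close>. Both therefore have the required sum.\<close>

lemma balanced_latin_cyclic: "balanced_latin (2 * h + 1) (cyclic_square h)"
proof -
  have row: "inj_on (cyclic_square h i) {..<2*h+1}" for i
    unfolding cyclic_square_def
    by (auto intro!: inj_onI intro: mod_shift_inject[where c = "i + (h + 1)" and n = "2 * h + 1"] simp: add_ac)
  have comm: "cyclic_square h i j = cyclic_square h j i" for i j
    by (simp add: cyclic_square_def add_ac)
  have "inj_on (\<lambda>i. cyclic_square h i j) {..<2*h+1}" for j
    using row by (subst comm)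
  moreover have "(\<Sum>i<2*h+1. cyclic_square h i (2 * h + 1 - Suc i)) = \<Sum>{..<2*h+1}"
    unfolding sum_middle[symmetric] by (intro sum.cong) (auto simp: cyclic_square_antidiagonal)
  ultimately show ?thesis
    using row sum_inj_on_lessThan[OF cyclic_square_diagonal_inj] cyclic_square_less
    unfolding balanced_latin_def by blast
qed

text \<open>Mirroring the columns swaps the two diagonals.\<close>

lemma balanced_latin_reflect:
  assumes "balanced_latin n L"
  shows "balanced_latin n (\<lambda>i j. L i (n - Suc j))"
proof -
  have "inj_on (L i \<circ> (\<lambda>j. n - Suc j)) {..<n}" if "i < n" for i
  proof (rule comp_inj_on)
    show "inj_on (\<lambda>j. n - Suc j) {..<n}" by (auto simp: inj_on_def)
    have "(\<lambda>j. n - Suc j) ` {..<n} \<subseteq> {..<n}" by auto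
    then show "inj_on (L i) ((\<lambda>j. n - Suc j) ` {..<n})"
      using assms that by (auto simp: balanced_latin_def intro: inj_on_subset)
  qed
  moreover have "(\<Sum>i<n. L i (n - Suc (n - Suc i))) = (\<Sum>i<n. L i i)"
    by (intro sum.cong) auto
  ultimately show ?thesis using assms by (auto simp: balanced_latin_def o_def)
qed

text \<open>Up to a constant the mirrored square is \<open>i - j\<close>. Adding the two entries
  cancels \<open>j\<close> and leaves \<open>2 * i\<close> plus a constant, which determines
  \<open>i\<close>; the row then determines \<open>j\<close>.\<close>

lemma orthogonal_cyclic:
  "orthogonal (2 * h + 1) (cyclic_square h) (\<lambda>i j. cyclic_square h i (2 * h - j))"
  unfolding orthogonal_def
proof (rule inj_onI, clarify)
  fix i j i' j'
  assume lt: "i < 2 * h + 1" "j < 2 * h + 1" "i' < 2 * h + 1" "j' < 2 * h + 1"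
    and eq: "cyclic_square h i j = cyclic_square h i' j'"
      "cyclic_square h i (2 * h - j) = cyclic_square h i' (2 * h - j')"
  define n where "n = 2 * h + 1"
  have "[i + j + (h + 1) = i' + j' + (h + 1)] (mod n)"
    "[i + (2 * h - j) + (h + 1) = i' + (2 * h - j') + (h + 1)] (mod n)"
    using eq by (simp_all only: cong_def cyclic_square_def n_def)
  then have "[(i + j + (h + 1)) + (i + (2 * h - j) + (h + 1)) =
      (i' + j' + (h + 1)) + (i' + (2 * h - j') + (h + 1))] (mod n)"
    by (rule cong_add)
  also have "(i + j + (h + 1)) + (i + (2 * h - j) + (h + 1)) = 2 * i + (4 * h + 2)"
    using lt by simp
  also have "(i' + j' + (h + 1)) + (i' + (2 * h - j') + (h + 1)) = 2 * i' + (4 * h + 2)"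
    using lt by simp
  finally have "i = i'"
    using lt unfolding cong_def n_def by (intro odd_double_mod_inject[of i "4 * h + 2" h i'])
  moreover have "inj_on (cyclic_square h i) {..<2*h+1}"
    using balanced_latin_cyclic lt by (simp add: balanced_latin_def)
  ultimately show "i = i' \<and> j = j'" using eq(1) lt by (auto dest: inj_onD)
qed

lemma balanced_mols_odd:
  "balanced_mols (2 * h + 1) (cyclic_square h) (\<lambda>i j. cyclic_square h i (2 * h - j))"
  using balanced_latin_cyclic[of h] balanced_latin_reflect[OF balanced_latin_cyclic, of h]
    orthogonal_cyclic[of h]
  by (simp add: balanced_mols_def)

text \<open>For \<open>h > 0\<close> the constant diagonal has at least two cells, here those in
  rows 0 and 1. In the mirrored square it is the main diagonal.\<close>

lemma not_distinct_diagonals_cyclic: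
  assumes "h > 0"
  shows "\<not> distinct_diagonals (2 * h + 1) (cyclic_square h)"
    and "\<not> distinct_diagonals (2 * h + 1) (\<lambda>i j. cyclic_square h i (2 * h - j))"
proof -
  have "\<not> inj_on (\<lambda>i. cyclic_square h i (2 * h - i)) {..<2*h+1}"
  proof
    assume "inj_on (\<lambda>i. cyclic_square h i (2 * h - i)) {..<2*h+1}"
    from inj_onD[OF this, of 0 1] show False
      using assms cyclic_square_antidiagonal[of 0 h] cyclic_square_antidiagonal[of 1 h] by simp
  qed
  then show "\<not> distinct_diagonals (2 * h + 1) (cyclic_square h)"
    "\<not> distinct_diagonals (2 * h + 1) (\<lambda>i j. cyclic_square h i (2 * h - j))"
    by (auto simp: distinct_diagonals_def)
qed

section \<open>Orders 4 and 8: linear squares over the field with two elements\<close>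

text \<open>The lists tabulate linear maps on bit vectors, and \<open>xor\<close> is vector
  addition. When \<open>n\<close> is a power of two, \<open>n - Suc j\<close> flips all bits of
  \<open>j\<close>, so the antidiagonal is the main diagonal translated by \<open>g\<close> of the
  all-ones vector, and its entries still pair up as complements.\<close>

definition xor_square :: "nat list \<Rightarrow> nat list \<Rightarrow> nat \<Rightarrow> nat \<Rightarrow> nat" where
  "xor_square f g i j = xor (f ! i) (g ! j)"

lemma ex_balanced_mols_4:
  "\<exists>K L. balanced_mols 4 K L \<and> \<not> distinct_diagonals 4 K \<and> \<not> distinct_diagonals 4 L"
proof -
  \<comment> \<open>Write \<open>f\<close>, \<open>g\<close> for the tables of \<open>?L\<close> and
    \<open>g'\<close> for the second table of \<open>?K\<close>, whose first is the identity. Then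
    \<open>f (g' j) + g j = j\<close>, so adding \<open>f\<close> of the \<open>?K\<close> entry to
    the \<open>?L\<close> entry recovers \<open>j\<close>, whence orthogonality.\<close>
  let ?K = "xor_square [0,1,2,3] [0,2,1,3]" and ?L = "xor_square [0,1,3,2] [0,2,3,1]"
  have "balanced_mols 4 ?K ?L \<and> \<not> distinct_diagonals 4 ?K \<and> \<not> distinct_diagonals 4 ?L"
    by code_simp
  then show ?thesis by blast
qed

text \<open>Order 8 cannot be obtained as 4 times 2, since there are no orthogonal Latin squares of
  order 2.\<close>

lemma ex_balanced_mols_8:
  "\<exists>K L. balanced_mols 8 K L \<and> \<not> distinct_diagonals 8 K \<and> \<not> distinct_diagonals 8 L"
proof -
  \<comment> \<open>Both first tables are the identity, so the sum of the two entries depends only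
    on \<open>j\<close>. It does so bijectively, because the sum of the two second tables is
    invertible; this gives orthogonality.\<close>
  let ?K = "xor_square [0,1,2,3,4,5,6,7] [0,1,4,5,3,2,7,6]"
    and ?L = "xor_square [0,1,2,3,4,5,6,7] [0,2,5,7,4,6,1,3]"
  have "balanced_mols 8 ?K ?L \<and> \<not> distinct_diagonals 8 ?K \<and> \<not> distinct_diagonals 8 ?L"
    by code_simp
  then show ?thesis by blast
qed

section \<open>Assembling all admissible orders\<close>

text \<open>The repeated diagonal entries are inherited from the first factor, so the second may
  even have order 1.\<close>

lemma ex_skew_balanced_mols_mult:
  assumes "\<exists>K L. balanced_mols k K L \<and> \<not> distinct_diagonals k K \<and> \<not> distinct_diagonals k L"
    and "balanced_mols m K' L'" "m > 0"
  shows "\<exists>K L. balanced_mols (k * m) K L \<and>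
    \<not> distinct_diagonals (k * m) K \<and> \<not> distinct_diagonals (k * m) L"
proof -
  obtain K L where KL: "balanced_mols k K L" "\<not> distinct_diagonals k K" "\<not> distinct_diagonals k L"
    using assms(1) by blast
  have "balanced_mols (k * m) (kronecker m K K') (kronecker m L L')"
    using KL(1) assms(2,3) by (rule balanced_mols_kronecker)
  moreover have "\<not> distinct_diagonals (k * m) (kronecker m K K')"
    "\<not> distinct_diagonals (k * m) (kronecker m L L')"
    using KL(2,3) assms(3) distinct_diagonals_kroneckerD by blast+
  ultimately show ?thesis by blast
qed

lemma ex_skew_balanced_mols:
  assumes "n \<ge> 3" "odd n \<or> 4 dvd n"
  shows "\<exists>K L. balanced_mols n K L \<and> \<not> distinct_diagonals n K \<and> \<not> distinct_diagonals n L"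
  using assms
proof (induction n rule: less_induct)
  case (less n)
  show ?case
  proof (cases "odd n")
    case True
    then obtain h where "n = 2 * h + 1" by (elim oddE)
    moreover have "h > 0" using less.prems calculation by simp
    ultimately show ?thesis
      using balanced_mols_odd not_distinct_diagonals_cyclic by blast
  next
    case False
    then obtain m where m: "n = 4 * m" using less.prems by blast
    have "m > 0" using less.prems m by simp
    \<comment> \<open>Splitting off 4 leaves an odd cofactor or a smaller multiple of 4, except when
      \<open>m\<close> is twice an odd number; the spare 2 is then joined to the 4, giving
      \<open>n = 8 * q\<close>.\<close>
    consider "odd m" | "4 dvd m" | q where "m = 2 * q" "odd q"
    proof (cases "odd m")
      case False
      then obtain q where q: "m = 2 * q" by blast
      then show ?thesis using that by (cases "odd q") auto
    qed
    then show ?thesis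
    proof cases
      case 1
      then obtain h where "m = 2 * h + 1" by (elim oddE)
      then show ?thesis
        using ex_skew_balanced_mols_mult[OF ex_balanced_mols_4 balanced_mols_odd[of h]] m by simp
    next
      case 2
      then have "m \<ge> 3" "m < n" using \<open>m > 0\<close> m by (auto dest: dvd_imp_le)
      then obtain K L where "balanced_mols m K L" using less.IH 2 by blast
      then show ?thesis
        using ex_skew_balanced_mols_mult[OF ex_balanced_mols_4] m \<open>m > 0\<close> by blast
    next
      case (3 q)
      then obtain h where "q = 2 * h + 1" by (elim oddE)
      then show ?thesis
        using ex_skew_balanced_mols_mult[OF ex_balanced_mols_8 balanced_mols_odd[of h]] m 3 by simp
    qed
  qed
qed

section \<open>Passing to indices and symbols from 1, and the magic sum\<close>

definition shifted_square :: "(nat \<Rightarrow> nat \<Rightarrow> nat) \<Rightarrow> square" where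
  "shifted_square L = (\<lambda>i j. 1 + int (L (i - 1) (j - 1)))"

lemma sum_shift_Icc: "(\<Sum>i=1..n. f (i - 1)) = (\<Sum>i<n. f i)" for n :: nat
  by (rule sum.reindex_bij_witness[where i = Suc and j = "\<lambda>i. i - 1"]) auto

text \<open>An injection between finite sets of equal size is onto.\<close>

lemma ex1_inj_on_value:
  fixes g :: "nat \<Rightarrow> int"
  assumes "inj_on g {1..n}" "\<And>j. j \<in> {1..n} \<Longrightarrow> g j \<in> {1..int n}" "k \<in> {1..int n}"
  shows "\<exists>!j. j \<in> {1..n} \<and> g j = k"
proof -
  have "g ` {1..n} = {1..int n}"
    using assms(1,2) by (intro card_subset_eq) (auto simp: card_image)
  with assms(3) obtain j where "j \<in> {1..n}" "g j = k" by (metis imageE)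
  with assms(1) show ?thesis by (metis inj_onD)
qed

lemma inj_on_shift:
  fixes f :: "nat \<Rightarrow> nat"
  assumes "inj_on f {..<n}"
  shows "inj_on (\<lambda>i. 1 + int (f (i - 1))) {1..n}"
proof (rule inj_onI)
  fix x y assume xy: "x \<in> {1..n}" "y \<in> {1..n}" "1 + int (f (x - 1)) = 1 + int (f (y - 1))"
  have "x - 1 = y - 1" by (rule inj_onD[OF assms]) (use xy in auto)
  then show "x = y" using xy by auto
qed

lemma latin_square_shifted:
  assumes "balanced_latin n L"
  shows "latin_square n (shifted_square L)"
proof -
  have range: "shifted_square L i j \<in> {1..int n}" if "i \<in> {1..n}" "j \<in> {1..n}" for i j
  proof -
    have "i - 1 < n" "j - 1 < n" using that by auto
    then have "L (i - 1) (j - 1) < n" using assms unfolding balanced_latin_def by blast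
    then show ?thesis by (simp add: shifted_square_def)
  qed
  moreover have "inj_on (shifted_square L i) {1..n}" if "i \<in> {1..n}" for i
  proof -
    have "i - 1 < n" using that by auto
    then have "inj_on (L (i - 1)) {..<n}" using assms unfolding balanced_latin_def by blast
    then show ?thesis unfolding shifted_square_def by (rule inj_on_shift)
  qed
  moreover have "inj_on (\<lambda>i. shifted_square L i j) {1..n}" if "j \<in> {1..n}" for j
  proof -
    have "j - 1 < n" using that by auto
    then have "inj_on (\<lambda>i. L i (j - 1)) {..<n}" using assms unfolding balanced_latin_def by blast
    then show ?thesis unfolding shifted_square_def by (rule inj_on_shift)
  qed
  ultimately show ?thesis
    unfolding latin_square_def by (intro conjI ballI ex1_inj_on_value) auto
qed

lemma orthogonal_squares_shifted:
  assumes "orthogonal n K L"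
  shows "orthogonal_squares n (shifted_square K) (shifted_square L)"
  unfolding orthogonal_squares_def
proof (rule inj_onI, clarify)
  fix i j i' j'
  assume ij: "i \<in> {1..n}" "j \<in> {1..n}" "i' \<in> {1..n}" "j' \<in> {1..n}"
    and eq: "shifted_square K i j = shifted_square K i' j'" "shifted_square L i j = shifted_square L i' j'"
  have "(i - 1, j - 1) = (i' - 1, j' - 1)"
    using assms[unfolded orthogonal_def]
    by (rule inj_onD) (use ij eq in \<open>auto simp: shifted_square_def\<close>)
  then show "i = i' \<and> j = j'" using ij by auto
qed

lemma double_diagonal_shiftedD:
  assumes "double_diagonal n (shifted_square L)"
  shows "distinct_diagonals n L"
  unfolding distinct_diagonals_def
proof (intro conjI inj_onI)
  fix x y assume xy: "x \<in> {..<n}" "y \<in> {..<n}" "L x x = L y y"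
  have "Suc x = Suc y"
    by (rule inj_onD[OF assms[unfolded double_diagonal_def, THEN conjunct1]])
      (use xy in \<open>auto simp: shifted_square_def\<close>)
  then show "x = y" by simp
next
  fix x y assume xy: "x \<in> {..<n}" "y \<in> {..<n}" "L x (n - Suc x) = L y (n - Suc y)"
  have "Suc x = Suc y"
    by (rule inj_onD[OF assms[unfolded double_diagonal_def, THEN conjunct2]])
      (use xy in \<open>auto simp: shifted_square_def\<close>)
  then show "x = y" by simp
qed

lemma sum_diagonals_shifted:
  assumes "balanced_latin n L"
  shows "(\<Sum>i=1..n. shifted_square L i i) = \<Sum>{1..int n}"
    and "(\<Sum>i=1..n. shifted_square L i (n + 1 - i)) = \<Sum>{1..int n}"
proof -
  have base: "int n + int (\<Sum>{..<n}) = \<Sum>{1..int n}"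
  proof -
    have "\<Sum>{1..int n} = (\<Sum>i=1..n. 1 + int (i - 1))"
      by (rule sum.reindex_bij_witness[where i = int and j = nat]) auto
    also have "\<dots> = (\<Sum>i<n. 1 + int i)" by (rule sum_shift_Icc)
    also have "\<dots> = int n + int (\<Sum>{..<n})" by (simp add: sum.distrib)
    finally show ?thesis ..
  qed
  have "(\<Sum>i=1..n. shifted_square L i i) = (\<Sum>i<n. 1 + int (L i i))"
    unfolding shifted_square_def by (rule sum_shift_Icc)
  also have "\<dots> = int n + int (\<Sum>i<n. L i i)" by (simp add: sum.distrib)
  finally show "(\<Sum>i=1..n. shifted_square L i i) = \<Sum>{1..int n}"
    using assms base by (simp only: balanced_latin_def)
  \<comment> \<open>For \<open>i\<close> in \<open>{1..n}\<close> the column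
    \<open>n + 1 - i\<close>, lowered by one, is the 0-based reflection of
    \<open>i - 1\<close>.\<close>
  have "(\<Sum>i=1..n. shifted_square L i (n + 1 - i)) = (\<Sum>i=1..n. 1 + int (L (i - 1) (n - Suc (i - 1))))"
    by (intro sum.cong) (auto simp: shifted_square_def)
  also have "\<dots> = (\<Sum>i<n. 1 + int (L i (n - Suc i)))" by (rule sum_shift_Icc)
  also have "\<dots> = int n + int (\<Sum>i<n. L i (n - Suc i))" by (simp add: sum.distrib)
  finally show "(\<Sum>i=1..n. shifted_square L i (n + 1 - i)) = \<Sum>{1..int n}"
    using assms base by (simp only: balanced_latin_def)
qed

lemma sum_ex1_value:
  fixes g :: "nat \<Rightarrow> int"
  assumes "\<And>j. j \<in> {1..n} \<Longrightarrow> g j \<in> {1..int n}"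
    and "\<forall>k\<in>{1..int n}. \<exists>!j. j \<in> {1..n} \<and> g j = k"
  shows "(\<Sum>j=1..n. g j) = \<Sum>{1..int n}"
proof -
  have "bij_betw g {1..n} {1..int n}"
    unfolding bij_betw_def
  proof
    show "inj_on g {1..n}" using assms by (intro inj_onI) metis
    show "g ` {1..n} = {1..int n}" using assms(1) ex1_implies_ex[OF bspec[OF assms(2)]] by blast
  qed
  then show ?thesis by (rule sum.reindex_bij_betw)
qed

text \<open>Less one, the entries are two-digit numbers in base \<open>n\<close> with digits
  \<open>A i j - 1\<close> and \<open>B i j - 1\<close>, so orthogonality makes them distinct. Every
  row, column and diagonal of both squares has the sum \<open>1 + ... + n\<close>, so the combined
  sums agree.\<close>

lemma magic_square_sumI:
  assumes A: "latin_square n A" and B: "latin_square n B" and AB: "orthogonal_squares n A B"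
    and diag: "(\<Sum>i=1..n. A i i) = \<Sum>{1..int n}" "(\<Sum>i=1..n. A i (n + 1 - i)) = \<Sum>{1..int n}"
      "(\<Sum>i=1..n. B i i) = \<Sum>{1..int n}" "(\<Sum>i=1..n. B i (n + 1 - i)) = \<Sum>{1..int n}"
  shows "magic_square n (square_sum n A B)"
proof -
  let ?M = "square_sum n A B"
  \<comment> \<open>The inner \<open>- int n\<close> collects the 1 subtracted from each of the
    \<open>n\<close> entries of \<open>A\<close> on a line.\<close>
  define s where "s = int n * (\<Sum>{1..int n} - int n) + \<Sum>{1..int n}"
  have s: "(\<Sum>i=1..n. int n * (f i - 1) + g i) = s"
    if "(\<Sum>i=1..n. f i) = \<Sum>{1..int n}" "(\<Sum>i=1..n. g i) = \<Sum>{1..int n}" for f g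
    using that by (simp add: s_def sum.distrib sum_subtractf flip: sum_distrib_left)
  have A1: "A i j \<in> {1..int n}" if "i \<in> {1..n}" "j \<in> {1..n}" for i j
    using A that by (auto simp: latin_square_def)
  have B1: "B i j \<in> {1..int n}" if "i \<in> {1..n}" "j \<in> {1..n}" for i j
    using B that by (auto simp: latin_square_def)
  have row: "(\<Sum>j=1..n. ?M i j) = s" if "i \<in> {1..n}" for i
    unfolding square_sum_def
    by (intro s sum_ex1_value) (use that A B A1 B1 in \<open>auto simp: latin_square_def\<close>)
  have col: "(\<Sum>i=1..n. ?M i j) = s" if "j \<in> {1..n}" for j
    unfolding square_sum_def
    by (intro s sum_ex1_value) (use that A B A1 B1 in \<open>auto simp: latin_square_def\<close>)
  have inj: "inj_on (\<lambda>(i, j). ?M i j) ({1..n} \<times> {1..n})"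
  proof (rule inj_onI, clarify)
    fix i j i' j'
    assume ij: "i \<in> {1..n}" "j \<in> {1..n}" "i' \<in> {1..n}" "j' \<in> {1..n}" and eq: "?M i j = ?M i' j'"
    have b: "0 \<le> B i j - 1" "B i j - 1 < int n" "0 \<le> B i' j' - 1" "B i' j' - 1 < int n"
      using B1[of i j] B1[of i' j'] ij by auto
    \<comment> \<open>In this form reduction modulo \<open>n\<close> isolates the low digit.\<close>
    have eq': "(B i j - 1) + int n * (A i j - 1) = (B i' j' - 1) + int n * (A i' j' - 1)"
      using eq by (simp add: square_sum_def)
    have "B i j - 1 = B i' j' - 1"
      using arg_cong[OF eq', of "\<lambda>x. x mod int n"] b by simp
    moreover from this have "A i j = A i' j'" using eq' ij by auto
    ultimately have "(i, j) = (i', j')"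
      by (intro inj_onD[OF AB[unfolded orthogonal_squares_def]]) (use ij in auto)
    then show "i = i' \<and> j = j'" by simp
  qed
  have "?M i j \<in> {1..(int n)\<^sup>2}" if "i \<in> {1..n}" "j \<in> {1..n}" for i j
  proof -
    have a: "0 \<le> A i j - 1" "A i j - 1 \<le> int n - 1" and b: "1 \<le> B i j" "B i j \<le> int n"
      using A1[of i j] B1[of i j] that by auto
    have "0 \<le> int n * (A i j - 1)" using a by simp
    moreover have "int n * (A i j - 1) \<le> int n * (int n - 1)"
      using a by (intro mult_left_mono) auto
    moreover have "int n * (int n - 1) + int n = (int n)\<^sup>2"
      by (simp add: power2_eq_square algebra_simps)
    ultimately show ?thesis using b unfolding square_sum_def atLeastAtMost_iff by linarith
  qed
  then have "(\<lambda>(i, j). ?M i j) ` ({1..n} \<times> {1..n}) \<subseteq> {1..(int n)\<^sup>2}" by auto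
  \<comment> \<open>The \<open>n * n\<close> distinct entries lie in an interval of that size, hence
    fill it.\<close>
  moreover have "card ((\<lambda>(i, j). ?M i j) ` ({1..n} \<times> {1..n})) = card {1..(int n)\<^sup>2}"
    unfolding card_image[OF inj] by (simp add: power2_eq_square nat_mult_distrib)
  ultimately have "(\<lambda>(i, j). ?M i j) ` ({1..n} \<times> {1..n}) = {1..(int n)\<^sup>2}"
    by (intro card_subset_eq) simp_all
  with inj have bij: "bij_betw (\<lambda>(i, j). ?M i j) ({1..n} \<times> {1..n}) {1..(int n)\<^sup>2}"
    by (simp add: bij_betw_def)
  have "(\<Sum>i=1..n. ?M i i) = s" "(\<Sum>i=1..n. ?M i (n + 1 - i)) = s"
    unfolding square_sum_def using s diag by blast+
  then show ?thesis unfolding magic_square_def using bij row col by blast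
qed

theorem corollary4p6:
  fixes n :: nat
  assumes "n \<ge> 3"
    and "\<not> (\<exists>r. odd r \<and> n = 2 * r)"
  shows "\<exists>A B. latin_square n A \<and> latin_square n B \<and> orthogonal_squares n A B \<and>
           \<not> double_diagonal n A \<and> \<not> double_diagonal n B \<and>
           magic_square n (square_sum n A B)"
proof -
  have "odd n \<or> 4 dvd n"
  proof (cases "odd n")
    case False
    then obtain r where "n = 2 * r" by blast
    moreover from this have "even r" using assms(2) by blast
    ultimately show ?thesis by auto
  qed simp
  then obtain K L where KL: "balanced_mols n K L" "\<not> distinct_diagonals n K" "\<not> distinct_diagonals n L"
    using ex_skew_balanced_mols assms(1) by blast
  then have "latin_square n (shifted_square K)" "latin_square n (shifted_square L)"
    "orthogonal_squares n (shifted_square K) (shifted_square L)"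
    by (simp_all add: balanced_mols_def latin_square_shifted orthogonal_squares_shifted)
  moreover from this have "magic_square n (square_sum n (shifted_square K) (shifted_square L))"
    using KL(1) by (intro magic_square_sumI) (simp_all only: balanced_mols_def sum_diagonals_shifted)
  ultimately show ?thesis using KL(2,3) double_diagonal_shiftedD by blast
qed

end
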